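(* Let $a$ be a positive integer and $k\geq 0$ an integer. Define the linear operator on the ring of symmetric functions $$CP_{a^k} = \sum_{\lambda:\ l(\lambda) \leq k} p_a^{k-l(\lambda)} \prod_{i=1}^{l(\lambda)} \left( p_{\lambda_i+a} - p_{\lambda_i} p_a \right) \frac{p_\lambda^\perp}{z_\lambda},$$ where the sum is over all partitions $\lambda$ with at most $k$ parts (in particular $CP_{a^0}=1$). Then for every partition $\mu$ with $l(\mu)<k$ we have $CP_{a^k}\, p_\mu = p_{\mu+a^k}$.
   Context: Work in the ring $\Lambda$ of symmetric functions over $\mathbb{Q}$ with power sums $p_\lambda=p_{\lambda_1}p_{\lambda_2}\cdots$ and the Hall inner product $\langle p_\lambda,p_\mu\rangle = z_\lambda\delta_{\lambda\mu}$, where $z_\lambda=\prod_{i\ge1} i^{n_i(\lambda)}n_i(\lambda)!$ and $n_i(\lambda)$ is the number of parts of $\lambda$ equal to $i$. For a symmetric function $f$, $f^\perp$ denotes the adjoint of multiplication by $f$: $\langle f^\perp P,Q\rangle=\langle P,fQ\rangle$. $l(\lambda)$ is the number of nonzero parts of $\lambda$. For a partition $\mu$ with $l(\mu)\le k$, $\mu+a^k$ denotes the partition $(\mu_1+a,\mu_2+a,\ldots,\mu_k+a)$, where $\mu_i=0$ for $i>l(\mu)$; so $p_{\mu+a^k}=\prod_{i=1}^k p_{\mu_i+a}$. *)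

theory Defs
  imports "HOL-Library.Multiset" "HOL-Library.Groups_Big_Fun" Complex_Main
begin

section \<open>The ring of symmetric functions over the rationals\<close>

text \<open>
  A monomial in the variables \<open>x\<^sub>0, x\<^sub>1, \<dots>\<close> is encoded as the multiset of the indices of its
  variables, so multiplication of monomials is addition of multisets and the degree is the size.
  A symmetric function is a formal power series (given by its coefficients) of bounded degree
  that is invariant under permutations of the variables.
\<close>

typedef symfun =
  "{f :: nat multiset \<Rightarrow> rat.
      (\<exists>d. \<forall>m. f m \<noteq> 0 \<longrightarrow> size m \<le> d) \<and> (\<forall>\<pi> m. bij \<pi> \<longrightarrow> f (image_mset \<pi> m) = f m)}"
  morphisms coeff Abs_symfun
  by (rule exI[of _ "\<lambda>_. 0"]) simp

setup_lifting type_definition_symfun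

lemma finite_mset_splits: "finite {(u, v). u + v = (m :: 'a multiset)}"
proof (induction m)
  case empty
  show ?case
    by (rule finite_subset[of _ "{({#}, {#})}"]) auto
next
  case (add x m)
  let ?S = "{(u, v). u + v = m}"
  have "{(u, v). u + v = add_mset x m}
      \<subseteq> map_prod (add_mset x) id ` ?S \<union> map_prod id (add_mset x) ` ?S"
  proof safe
    fix u v
    assume uv: "u + v = add_mset x m" and *: "(u, v) \<notin> map_prod id (add_mset x) ` ?S"
    from uv have "x \<in># u \<or> x \<in># v"
      by (metis union_iff union_single_eq_member)
    then show "(u, v) \<in> map_prod (add_mset x) id ` ?S"
    proof
      assume "x \<in># u"
      then obtain u' where "u = add_mset x u'"
        by (metis multi_member_split)
      with uv show ?thesis
        by (auto intro: image_eqI[of _ _ "(u', v)"])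
    next
      assume "x \<in># v"
      then obtain v' where "v = add_mset x v'"
        by (metis multi_member_split)
      with uv have "(u, v) \<in> map_prod id (add_mset x) ` ?S"
        by (auto intro: image_eqI[of _ _ "(u, v')"])
      with * show ?thesis
        by contradiction
    qed
  qed
  with add show ?case
    by (meson finite_UnI finite_imageI finite_subset)
qed

instantiation symfun :: comm_ring_1
begin

lift_definition zero_symfun :: symfun is "\<lambda>_. 0"
  by simp

lift_definition one_symfun :: symfun is "\<lambda>m. if m = {#} then 1 else 0"
  by auto

lift_definition plus_symfun :: "symfun \<Rightarrow> symfun \<Rightarrow> symfun" is "\<lambda>f g m. f m + g m"
proof safe
  fix f g :: "nat multiset \<Rightarrow> rat" and d e
  assume "\<forall>m. f m \<noteq> 0 \<longrightarrow> size m \<le> d" "\<forall>m. g m \<noteq> 0 \<longrightarrow> size m \<le> e"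
  then have "\<forall>m. f m + g m \<noteq> 0 \<longrightarrow> size m \<le> max d e"
    by (metis add.right_neutral max.coboundedI1 max.coboundedI2)
  then show "\<exists>d. \<forall>m. f m + g m \<noteq> 0 \<longrightarrow> size m \<le> d" ..
qed simp

lift_definition uminus_symfun :: "symfun \<Rightarrow> symfun" is "\<lambda>f m. - f m"
  by simp

definition minus_symfun :: "symfun \<Rightarrow> symfun \<Rightarrow> symfun" where
  "f - g = f + - (g :: symfun)"

lift_definition times_symfun :: "symfun \<Rightarrow> symfun \<Rightarrow> symfun"
  is "\<lambda>f g m. \<Sum>(u, v) | u + v = m. f u * g v"
proof (intro conjI allI impI; elim conjE exE)
  fix f g :: "nat multiset \<Rightarrow> rat" and d e
  assume f: "\<forall>m. f m \<noteq> 0 \<longrightarrow> size m \<le> d" and g: "\<forall>m. g m \<noteq> 0 \<longrightarrow> size m \<le> e"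
  have "size m \<le> d + e" if "(\<Sum>(u, v) | u + v = m. f u * g v) \<noteq> 0" for m
  proof -
    from that obtain u v where "u + v = m" "f u * g v \<noteq> 0"
      by (auto elim: sum.not_neutral_contains_not_neutral)
    with f g show ?thesis
      by (metis add_mono mult_zero_left mult_zero_right size_union)
  qed
  then show "\<exists>d. \<forall>m. (\<Sum>(u, v) | u + v = m. f u * g v) \<noteq> 0 \<longrightarrow> size m \<le> d"
    by blast
next
  fix f g :: "nat multiset \<Rightarrow> rat" and \<pi> :: "nat \<Rightarrow> nat" and m
  assume \<pi>: "bij \<pi>"
    and f: "\<forall>\<pi> m. bij \<pi> \<longrightarrow> f (image_mset \<pi> m) = f m"
    and g: "\<forall>\<pi> m. bij \<pi> \<longrightarrow> g (image_mset \<pi> m) = g m"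
  have *: "image_mset (inv \<pi>) (image_mset \<pi> u) = u" "image_mset \<pi> (image_mset (inv \<pi>) u) = u" for u
    using \<pi> by (simp_all add: multiset.map_comp bij_is_inj bij_is_surj surj_iff[THEN iffD1])
  show "(\<Sum>(u, v) | u + v = image_mset \<pi> m. f u * g v) = (\<Sum>(u, v) | u + v = m. f u * g v)"
    by (rule sum.reindex_bij_witness
          [where i = "map_prod (image_mset \<pi>) (image_mset \<pi>)"
             and j = "map_prod (image_mset (inv \<pi>)) (image_mset (inv \<pi>))"])
       (use f g \<pi> * bij_imp_bij_inv[OF \<pi>] in \<open>auto simp flip: image_mset_union\<close>)
qed

instance
proof
  fix f g h :: symfun
  show "f + g + h = f + (g + h)" "f + g = g + f" "0 + f = f" "- f + f = 0"
    by (transfer; simp add: algebra_simps)+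
  show "f - g = f + - g"
    by (rule minus_symfun_def)
  show "f * g = g * f"
    by (transfer, rule ext,
        rule sum.reindex_bij_witness[where i = prod.swap and j = prod.swap])
       (auto simp: add.commute)
  show "(f + g) * h = f * h + g * h"
    by transfer (simp add: algebra_simps case_prod_unfold sum.distrib)
  show "1 * f = f"
  proof (transfer, rule ext)
    fix f :: "nat multiset \<Rightarrow> rat" and m
    have "(\<Sum>(u, v) | u + v = m. (if u = {#} then 1 else 0) * f v)
        = (\<Sum>(u, v) \<in> {({#} :: nat multiset, m)}. (if u = {#} then 1 else 0) * f v)"
      by (rule sum.mono_neutral_right) (use finite_mset_splits in \<open>auto split: if_splits\<close>)
    then show "(\<Sum>(u, v) | u + v = m. (if u = {#} then 1 else 0) * f v) = f m"
      by simp
  qed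
  show "f * g * h = f * (g * h)"
  proof (transfer, rule ext)
    fix f g h :: "nat multiset \<Rightarrow> rat" and m
    have "(\<Sum>(w, c) | w + c = m. (\<Sum>(a, b) | a + b = w. f a * g b) * h c)
        = (\<Sum>((w, c), (a, b)) \<in> (SIGMA x:{(w, c). w + c = m}. {(a, b). a + b = fst x}).
             f a * g b * h c)"
      by (simp add: sum_distrib_right case_prod_unfold,
          subst sum.Sigma) (simp_all add: finite_mset_splits[unfolded case_prod_unfold]
            case_prod_unfold)
    also have "\<dots> = (\<Sum>((a, w), (b, c)) \<in> (SIGMA x:{(a, w). a + w = m}. {(b, c). b + c = snd x}).
             f a * (g b * h c))"
      by (rule sum.reindex_bij_witness
            [where i = "\<lambda>((a, w), (b, c)). ((a + b, c), (a, b))"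
               and j = "\<lambda>((w, c), (a, b)). ((a, b + c), (b, c))"])
         (auto simp: add.assoc)
    also have "\<dots> = (\<Sum>(a, w) | a + w = m. f a * (\<Sum>(b, c) | b + c = w. g b * h c))"
      by (simp add: sum_distrib_left case_prod_unfold,
          subst sum.Sigma) (simp_all add: finite_mset_splits[unfolded case_prod_unfold]
            case_prod_unfold)
    finally show "(\<Sum>(w, c) | w + c = m. (\<Sum>(a, b) | a + b = w. f a * g b) * h c)
        = (\<Sum>(a, w) | a + w = m. f a * (\<Sum>(b, c) | b + c = w. g b * h c))" .
  qed
  show "(0 :: symfun) \<noteq> 1"
    by transfer (metis zero_neq_one)
qed

end

lift_definition scale :: "rat \<Rightarrow> symfun \<Rightarrow> symfun" is "\<lambda>c f m. c * f m"
  by auto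

lemma vector_space_scale: "vector_space scale"
  by unfold_locales (transfer; simp add: algebra_simps)+

lemma scale_mult_left: "scale c f * g = scale c (f * g)"
  by transfer (simp add: sum_distrib_left case_prod_unfold mult.assoc)

lemma scale_mult_right: "f * scale c g = scale c (f * g)"
  by (metis scale_mult_left mult.commute)


section \<open>Partitions and power sums\<close>

text \<open>A partition is the weakly decreasing list of its nonzero parts.\<close>

definition is_partition :: "nat list \<Rightarrow> bool" where
  "is_partition \<nu> \<longleftrightarrow> sorted_wrt (\<ge>) \<nu> \<and> 0 \<notin> set \<nu>"

text \<open>The parts of \<open>\<nu>\<close>, indexed from \<open>0\<close> and continued by zeros.\<close>

definition nth_part :: "nat list \<Rightarrow> nat \<Rightarrow> nat" where
  "nth_part \<nu> i = (if i < length \<nu> then \<nu> ! i else 0)"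

text \<open>The partition \<open>\<mu> + a\<^sup>k\<close>, for \<open>length \<mu> \<le> k\<close>.\<close>

definition add_rect :: "nat list \<Rightarrow> nat \<Rightarrow> nat \<Rightarrow> nat list" where
  "add_rect \<mu> a k = map (\<lambda>i. nth_part \<mu> i + a) [0..<k]"

definition z_partition :: "nat list \<Rightarrow> rat" where
  "z_partition \<nu> = (\<Prod>i\<in>set \<nu>. of_nat (i ^ count_list \<nu> i * fact (count_list \<nu> i)))"

text \<open>
  The power sum \<open>psum n = (\<Sum>i. x\<^sub>i ^ n)\<close>. It is only meaningful for \<open>n > 0\<close>; the formula
  gives \<open>psum 0 = 1\<close>.
\<close>

lift_definition psum :: "nat \<Rightarrow> symfun"
  is "\<lambda>n m. if \<exists>i. m = replicate_mset n i then 1 else 0"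
proof safe
  fix n
  show "\<exists>d. \<forall>m. (if \<exists>i. m = replicate_mset n i then 1 else 0 :: rat) \<noteq> 0 \<longrightarrow> size m \<le> d"
    by (rule exI[of _ n]) auto
  fix \<pi> :: "nat \<Rightarrow> nat" and m
  assume \<pi>: "bij \<pi>"
  have "(\<exists>i. image_mset \<pi> m = replicate_mset n i) \<longleftrightarrow> (\<exists>i. m = replicate_mset n i)"
  proof
    assume "\<exists>i. image_mset \<pi> m = replicate_mset n i"
    then obtain i where "image_mset \<pi> m = replicate_mset n i" ..
    then have "image_mset (inv \<pi>) (image_mset \<pi> m) = replicate_mset n (inv \<pi> i)"
      by simp
    then show "\<exists>i. m = replicate_mset n i"
      using \<pi> by (auto simp: multiset.map_comp bij_is_inj)
  qed auto
  then show "(if \<exists>i. image_mset \<pi> m = replicate_mset n i then 1 else 0 :: rat)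
      = (if \<exists>i. m = replicate_mset n i then 1 else 0)"
    by simp
qed

definition psums :: "nat list \<Rightarrow> symfun" where
  "psums \<nu> = prod_list (map psum \<nu>)"


section \<open>The Hall inner product, adjoints and the operators \<open>CP\<close>\<close>

definition bilinear_form :: "(symfun \<Rightarrow> symfun \<Rightarrow> rat) \<Rightarrow> bool" where
  "bilinear_form B \<longleftrightarrow>
     (\<forall>f. Vector_Spaces.linear scale (*) (B f)) \<and>
     (\<forall>g. Vector_Spaces.linear scale (*) (\<lambda>f. B f g))"

text \<open>
  The form is unique and exists because the \<open>psums \<nu>\<close>, for \<open>\<nu>\<close> ranging over the partitions,
  form a basis.
\<close>

definition hall :: "symfun \<Rightarrow> symfun \<Rightarrow> rat" where
  "hall = (THE B. bilinear_form B \<and>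
     (\<forall>\<nu> \<mu>. is_partition \<nu> \<longrightarrow> is_partition \<mu> \<longrightarrow>
        B (psums \<nu>) (psums \<mu>) = (if \<nu> = \<mu> then z_partition \<nu> else 0)))"

definition perp :: "symfun \<Rightarrow> symfun \<Rightarrow> symfun" where
  "perp f P = (THE R. \<forall>Q. hall R Q = hall P (f * Q))"

text \<open>
  For every \<open>P\<close>, only finitely many summands of \<open>CP a k P\<close> are nonzero, because
  \<open>perp (psums \<nu>) P = 0\<close> whenever the size of \<open>\<nu>\<close> exceeds the degree of \<open>P\<close>.
\<close>

definition CP :: "nat \<Rightarrow> nat \<Rightarrow> symfun \<Rightarrow> symfun" where
  "CP a k P = Sum_any (\<lambda>\<nu>.
     if is_partition \<nu> \<and> length \<nu> \<le> k
     then psum a ^ (k - length \<nu>) * (\<Prod>i<length \<nu>. psum (\<nu> ! i + a) - psum (\<nu> ! i) * psum a)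
            * scale (1 / z_partition \<nu>) (perp (psums \<nu>) P)
     else 0)"

end

theory Submission
  imports Defs "HOL-Combinatorics.Transposition"
begin

text \<open>
  Power sum products are indexed by multisets \<open>M\<close> of positive integers and form an orthogonal
  basis. Hence, up to the factor \<open>z(N)\<close>, the adjoint of multiplication by \<open>p(N)\<close> sends \<open>p(M)\<close> to
  \<open>p(M - N)\<close> times a product of binomial coefficients of multiplicities if \<open>N \<subseteq># M\<close>, and to \<open>0\<close>
  otherwise. For \<open>size M \<le> k\<close>, distributing one factor \<open>p(a)\<close> to each part of \<open>M - N\<close> turns the
  sum defining \<open>CP\<close> into \<open>p(a) ^ (k - size M)\<close> times the binomial expansion of the product of
  \<open>(p(n + a) - p(n) p(a)) + p(n) p(a)\<close> over the parts \<open>n\<close> of \<open>M\<close>.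
\<close>

section \<open>Exponents of monomials\<close>

text \<open>A monomial is a multiset of variables, so its exponents are its multiplicities. The
  multiset of exponents is the orbit type of the monomial under permutations of the variables; such
  types index the monomial symmetric functions.\<close>

definition exponents :: "nat multiset \<Rightarrow> nat multiset" where
  "exponents m = image_mset (count m) (mset_set (set_mset m))"

lemma exponents_empty [simp]: "exponents {#} = {#}"
  by (simp add: exponents_def)

lemma size_exponents: "size (exponents m) = card (set_mset m)"
  by (simp add: exponents_def)

lemma zero_notin_exponents: "0 \<notin># exponents m"
  by (auto simp: exponents_def count_eq_zero_iff)

lemma exponents_replicate_plus:
  assumes "i \<notin># v" "n > 0"
  shows "exponents (replicate_mset n i + v) = add_mset n (exponents v)"
proof -
  have s: "set_mset (replicate_mset n i + v) = insert i (set_mset v)"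
    using assms by auto
  have "image_mset (count (replicate_mset n i + v)) (mset_set (set_mset v))
      = image_mset (count v) (mset_set (set_mset v))"
    by (rule image_mset_cong) (use assms in auto)
  then show ?thesis
    unfolding exponents_def s using assms by (simp add: not_in_iff)
qed

text \<open>Peeling one variable of exponent \<open>n\<close> off a monomial lets inductions over
  orbit types run on monomials.\<close>

lemma exponents_eq_addE:
  assumes "exponents m = add_mset n M"
  obtains i v where "m = replicate_mset n i + v" "i \<notin># v" "n > 0" "exponents v = M"
proof -
  from assms have "n \<in># exponents m"
    by simp
  then obtain i where i: "i \<in># m" "count m i = n"
    by (auto simp: exponents_def)
  define v where "v = filter_mset (\<lambda>x. x \<noteq> i) m"
  have m: "m = replicate_mset n i + v"
    by (rule multiset_eqI) (use i in \<open>auto simp: v_def\<close>)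
  have "i \<notin># v" "n > 0"
    using i by (auto simp: v_def)
  moreover from this have "exponents v = M"
    using assms m exponents_replicate_plus by auto
  ultimately show ?thesis
    using that m by blast
qed

lemma ex_exponents:
  assumes "0 \<notin># M"
  shows "\<exists>m. exponents m = M"
  using assms
proof (induction M)
  case empty
  show ?case
    using exponents_empty by blast
next
  case (add n M)
  then obtain v where v: "exponents v = M"
    by auto
  obtain i where "i \<notin># v"
    using ex_new_if_finite[OF infinite_UNIV_nat finite_set_mset] by blast
  then have "exponents (replicate_mset n i + v) = add_mset n M"
    using add.prems v by (subst exponents_replicate_plus) auto
  then show ?case ..
qed

text \<open>Peel off a variable of the same exponent from each monomial, match the remainders by
  induction, and then correct the bijection at the single peeled variable.\<close>

lemma exponents_eq_imp_permuted:
  assumes "exponents m = M" "exponents m' = M"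
  shows "\<exists>\<pi>. bij \<pi> \<and> image_mset \<pi> m = m'"
  using assms
proof (induction M arbitrary: m m')
  case empty
  then have "card (set_mset m) = 0" "card (set_mset m') = 0"
    by (metis size_empty size_exponents)+
  then have "m = {#}" "m' = {#}"
    by auto
  then show ?case
    using bij_id by (metis image_mset_empty)
next
  case (add n M)
  obtain i v where m: "m = replicate_mset n i + v" "i \<notin># v" "exponents v = M"
    using add.prems(1) by (rule exponents_eq_addE)
  obtain i' v' where m': "m' = replicate_mset n i' + v'" "i' \<notin># v'" "exponents v' = M"
    using add.prems(2) by (rule exponents_eq_addE)
  obtain \<sigma> where \<sigma>: "bij \<sigma>" "image_mset \<sigma> v = v'"
    using add.IH m m' by blast
  \<comment> \<open>The transposition redirects the image of \<open>i\<close> to \<open>i'\<close>.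
    It does not disturb the images of the variables of \<open>v\<close>: these avoid
    \<open>\<sigma> i\<close> by injectivity, and avoid \<open>i'\<close> because they lie in
    \<open>v'\<close>.\<close>
  let ?\<pi> = "transpose (\<sigma> i) i' \<circ> \<sigma>"
  have "image_mset ?\<pi> v = image_mset \<sigma> v"
  proof (rule image_mset_cong)
    fix j assume j: "j \<in># v"
    with m have "\<sigma> j \<noteq> \<sigma> i"
      using \<sigma>(1) by (metis bij_pointE)
    moreover from j have "\<sigma> j \<noteq> i'"
      using \<sigma>(2) m'(2) by auto
    ultimately show "?\<pi> j = \<sigma> j"
      by simp
  qed
  then have "image_mset ?\<pi> m = m'"
    using m m' \<sigma> by simp
  moreover have "bij ?\<pi>"
    using \<sigma> by (simp add: bij_comp)
  ultimately show ?case
    by blast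
qed

text \<open>A symmetric function is thus known from one coefficient per orbit type.\<close>

lemma coeff_cong_exponents:
  assumes "exponents m = exponents m'"
  shows "coeff f m = coeff f m'"
proof -
  obtain \<pi> where "bij \<pi>" "image_mset \<pi> m = m'"
    using exponents_eq_imp_permuted assms by blast
  then show ?thesis
    using coeff[of f] by auto
qed


section \<open>Power sum products form a basis\<close>

interpretation symfun: vector_space scale
  by (rule vector_space_scale)

lemma coeff_sum: "coeff (sum g S) m = (\<Sum>x\<in>S. coeff (g x) m)"
  by (induction S rule: infinite_finite_induct)
     (simp_all add: zero_symfun.rep_eq plus_symfun.rep_eq)

lemma coeff_diff: "coeff (f - g) m = coeff f m - coeff g m"
  by (simp only: minus_symfun_def plus_symfun.rep_eq uminus_symfun.rep_eq diff_conv_add_uminus)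

definition power_sums :: "nat multiset \<Rightarrow> symfun" where
  "power_sums M = (\<Prod>n\<in>#M. psum n)"

lemma power_sums_empty [simp]: "power_sums {#} = 1"
  by (simp add: power_sums_def)

lemma power_sums_add_mset [simp]: "power_sums (add_mset n M) = psum n * power_sums M"
  by (simp add: power_sums_def)

lemma power_sums_union: "power_sums (M + N) = power_sums M * power_sums N"
  by (simp add: power_sums_def)

lemma psums_eq_power_sums: "psums \<nu> = power_sums (mset \<nu>)"
  by (simp add: psums_def power_sums_def flip: prod_mset_prod_list)

section \<open>Triangularity of power sum products with respect to orbit types\<close>

lemma coeff_power_sums_nonneg: "coeff (power_sums M) m \<ge> 0"
proof (induction M arbitrary: m)
  case empty
  then show ?case
    by (simp add: one_symfun.rep_eq)
next
  case (add n M)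
  then show ?case
    by (auto simp: times_symfun.rep_eq psum.rep_eq intro!: sum_nonneg)
qed

text \<open>All coefficients are nonnegative, so nothing cancels in the convolution: the sum is
  nonzero as soon as one of its terms is.\<close>

lemma coeff_power_sums_add_mset_neq_0_iff:
  "coeff (power_sums (add_mset n M)) m \<noteq> 0
    \<longleftrightarrow> (\<exists>i v. m = replicate_mset n i + v \<and> coeff (power_sums M) v \<noteq> 0)"
proof -
  let ?g = "\<lambda>(u, v). coeff (psum n) u * coeff (power_sums M) v"
  have "coeff (power_sums (add_mset n M)) m = sum ?g {(u, v). u + v = m}"
    by (simp add: times_symfun.rep_eq)
  also have "sum ?g {(u, v). u + v = m} = 0 \<longleftrightarrow> (\<forall>x\<in>{(u, v). u + v = m}. ?g x = 0)"
    by (rule sum_nonneg_eq_0_iff)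
       (auto simp: finite_mset_splits psum.rep_eq coeff_power_sums_nonneg)
  finally have "coeff (power_sums (add_mset n M)) m \<noteq> 0
      \<longleftrightarrow> (\<exists>x\<in>{(u, v). u + v = m}. ?g x \<noteq> 0)"
    by blast
  also have "\<dots> \<longleftrightarrow> (\<exists>u v. m = u + v \<and> (\<exists>i. u = replicate_mset n i) \<and> coeff (power_sums M) v \<noteq> 0)"
    by (auto simp: psum.rep_eq split: if_splits)
  finally show ?thesis
    by blast
qed

text \<open>Multiplication by \<open>psum n\<close> either brings in a fresh variable of exponent
  \<open>n\<close> or raises the exponent of a variable already present. In the second case the
  number of variables falls behind the number of parts and never catches up.\<close>

lemma coeff_power_sums_neq_0D:
  assumes "coeff (power_sums M) m \<noteq> 0" "0 \<notin># M"
  shows "size (exponents m) < size M \<or> exponents m = M"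
  using assms
proof (induction M arbitrary: m)
  case empty
  then show ?case
    by (auto simp: one_symfun.rep_eq split: if_splits)
next
  case (add n M)
  then obtain i v where m: "m = replicate_mset n i + v" and v: "coeff (power_sums M) v \<noteq> 0"
    using coeff_power_sums_add_mset_neq_0_iff by blast
  from add v have IH: "size (exponents v) < size M \<or> exponents v = M"
    by auto
  show ?case
  proof (cases "i \<in># v")
    case True
    then have "set_mset m = set_mset v"
      using m by auto
    then have "size (exponents m) = size (exponents v)"
      by (simp add: size_exponents)
    then show ?thesis
      using IH by auto
  next
    case False
    with add.prems m have "exponents m = add_mset n (exponents v)"
      by (auto simp: exponents_replicate_plus)
    then show ?thesis
      using IH by auto
  qed
qed

text \<open>The diagonal of the triangular system: taking a different variable for each part of
  \<open>M\<close> produces the monomial \<open>m\<close>.\<close>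

lemma coeff_power_sums_exponents_neq_0:
  assumes "exponents m = M"
  shows "coeff (power_sums M) m \<noteq> 0"
  using assms
proof (induction M arbitrary: m)
  case empty
  then have "card (set_mset m) = 0"
    by (metis size_empty size_exponents)
  then show ?case
    by (simp add: one_symfun.rep_eq)
next
  case (add n M)
  then show ?case
    by (metis coeff_power_sums_add_mset_neq_0_iff exponents_eq_addE)
qed

section \<open>Linear independence\<close>

lemma power_sums_independent:
  assumes "finite S" "\<And>M. M \<in> S \<Longrightarrow> 0 \<notin># M"
    and "(\<Sum>M\<in>S. scale (c M) (power_sums M)) = 0"
    and "N \<in> S"
  shows "c N = 0"
proof (rule ccontr)
  assume "c N \<noteq> 0"
  let ?S = "{M \<in> S. c M \<noteq> 0}"
  have "finite (size ` ?S)" "size ` ?S \<noteq> {}"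
    using assms \<open>c N \<noteq> 0\<close> by auto
  \<comment> \<open>By triangularity, a monomial of type \<open>M\<close> occurs only in
    \<open>power_sums M\<close> itself and in products with more parts than \<open>M\<close>.
    Maximality of the size excludes the latter, so its coefficient in the relation is
    \<open>c M\<close> times a nonzero number.\<close>
  then obtain M where M: "M \<in> ?S" "size M = Max (size ` ?S)"
    by (metis (no_types, lifting) Max_in imageE)
  then have max: "size K \<le> size M" if "K \<in> ?S" for K
    using that \<open>finite (size ` ?S)\<close> by simp
  obtain m where m: "exponents m = M"
    using ex_exponents assms(2) M by blast
  have "0 = coeff (\<Sum>M\<in>S. scale (c M) (power_sums M)) m"
    by (simp add: assms(3) zero_symfun.rep_eq)
  also have "\<dots> = (\<Sum>K\<in>S. c K * coeff (power_sums K) m)"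
    by (simp add: coeff_sum scale.rep_eq)
  also have "\<dots> = (\<Sum>K\<in>{M}. c K * coeff (power_sums K) m)"
  proof (rule sum.mono_neutral_right)
    show "\<forall>K\<in>S - {M}. c K * coeff (power_sums K) m = 0"
    proof (rule ballI, rule ccontr)
      fix K assume K: "K \<in> S - {M}" "c K * coeff (power_sums K) m \<noteq> 0"
      then have "size M < size K \<or> M = K"
        using coeff_power_sums_neq_0D[of K m] m assms(2) by auto
      moreover have "size K \<le> size M"
        using K max by auto
      ultimately show False
        using K by auto
    qed
  qed (use assms M in auto)
  finally show False
    using M m coeff_power_sums_exponents_neq_0 by auto
qed

lemma inj_on_power_sums: "inj_on power_sums {M. 0 \<notin># M}"
proof (rule inj_onI, rule ccontr)
  fix M N assume *: "M \<in> {M. 0 \<notin># M}" "N \<in> {M. 0 \<notin># M}"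
    "power_sums M = power_sums N" "M \<noteq> N"
  have "(\<Sum>K\<in>{M, N}. scale (if K = M then 1 else - 1) (power_sums K)) = 0"
    using * by simp
  from power_sums_independent[OF _ _ this, of M] * show False
    by auto
qed

definition power_sum_basis :: "symfun set" where
  "power_sum_basis = power_sums ` {M. 0 \<notin># M}"

lemma independent_power_sum_basis: "symfun.independent power_sum_basis"
proof
  assume "symfun.dependent power_sum_basis"
  then obtain t u v where t: "finite t" "t \<subseteq> power_sum_basis"
    "(\<Sum>v\<in>t. scale (u v) v) = 0" "v \<in> t" "u v \<noteq> 0"
    unfolding symfun.dependent_explicit by blast
  obtain S where S: "S \<subseteq> {M. 0 \<notin># M}" "inj_on power_sums S" "t = power_sums ` S"
    using t(2) unfolding power_sum_basis_def subset_image_inj by blast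
  have "finite S"
    using S t finite_imageD by blast
  moreover have "(\<Sum>M\<in>S. scale (u (power_sums M)) (power_sums M)) = 0"
    using t(3) S by (simp add: sum.reindex)
  moreover obtain N where "N \<in> S" "v = power_sums N"
    using t S by blast
  ultimately show False
    using power_sums_independent[of S "u \<circ> power_sums" N] S t by auto
qed

section \<open>Spanning\<close>

lemma size_eq_sum_mset_exponents: "size (m :: nat multiset) = sum_mset (exponents m)"
  by (simp add: size_multiset_overloaded_eq exponents_def sum_unfold_sum_mset)

lemma finite_bounded_msets:
  assumes "finite A"
  shows "finite {M. set_mset M \<subseteq> A \<and> size M \<le> n}"
proof (rule finite_subset)
  show "{M. set_mset M \<subseteq> A \<and> size M \<le> n} \<subseteq> mset ` {xs. set xs \<subseteq> A \<and> length xs \<le> n}"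
  proof
    fix M assume M: "M \<in> {M. set_mset M \<subseteq> A \<and> size M \<le> n}"
    obtain xs where "M = mset xs"
      by (metis ex_mset)
    with M show "M \<in> mset ` {xs. set xs \<subseteq> A \<and> length xs \<le> n}"
      by auto
  qed
  show "finite (mset ` {xs. set xs \<subseteq> A \<and> length xs \<le> n})"
    using assms by (intro finite_imageI finite_lists_length_le)
qed

text \<open>Both the exponents and their number are bounded by the degree. A function of bounded
  degree therefore involves only finitely many orbit types, although it may have infinitely many
  monomials.\<close>

lemma finite_exponents_bounded_size: "finite (exponents ` {m. size m \<le> d})"
proof (rule finite_subset)
  show "exponents ` {m :: nat multiset. size m \<le> d} \<subseteq> {M. set_mset M \<subseteq> {..d} \<and> size M \<le> d}"
  proof (safe; clarsimp)
    fix m :: "nat multiset" and n assume "size m \<le> d"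
    show "n \<le> d" if n: "n \<in># exponents m"
    proof -
      obtain M where "exponents m = add_mset n M"
        using n by (metis multi_member_split)
      then show ?thesis
        using \<open>size m \<le> d\<close> size_eq_sum_mset_exponents[of m] by simp
    qed
    have "size (exponents m) \<le> size m"
      unfolding size_exponents size_multiset_overloaded_eq[of m]
      using sum_mono[of "set_mset m" "\<lambda>_. 1" "count m"] by (simp add: Suc_le_eq)
    then show "size (exponents m) \<le> d"
      using \<open>size m \<le> d\<close> by simp
  qed
qed (simp add: finite_bounded_msets)

text \<open>
  \<open>power_sums M\<close> is a nonzero multiple of the monomial symmetric function of \<open>M\<close> plus terms with
  fewer distinct variables, so the terms with the most variables can be eliminated successively.
\<close>

lemma in_span_power_sum_basis:
  assumes "\<And>m. coeff f m \<noteq> 0 \<Longrightarrow> size (exponents m) < L"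
  shows "f \<in> symfun.span power_sum_basis"
  using assms
proof (induction L arbitrary: f)
  case 0
  then have "coeff f m = coeff 0 m" for m
    by (auto simp: zero_symfun.rep_eq)
  then have "f = 0"
    by (metis coeff_inject ext)
  then show ?case
    by (simp add: symfun.span_zero)
next
  case (Suc L)
  obtain d where d: "\<And>m. coeff f m \<noteq> 0 \<Longrightarrow> size m \<le> d"
    using coeff[of f] by auto
  \<comment> \<open>These are the orbit types with the largest number of variables that
    \<open>f\<close> may still contain.\<close>
  define S where "S = {M \<in> exponents ` {m. size m \<le> d}. size M = L}"
  have "finite S"
    unfolding S_def using finite_exponents_bounded_size by simp
  have S0: "0 \<notin># M" if "M \<in> S" for M
    using that zero_notin_exponents by (auto simp: S_def)
  \<comment> \<open>\<open>w M\<close> is a representative monomial of type \<open>M\<close>; it is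
    meaningful only when \<open>M\<close> is the type of some monomial.\<close>
  define w where "w M = (SOME m. exponents m = M)" for M
  have w: "exponents (w (exponents m)) = exponents m" for m
    unfolding w_def by (rule someI[of _ m]) simp
  \<comment> \<open>The quotient makes \<open>f\<close> and \<open>g\<close> agree at the
    representative of each type in \<open>S\<close>. Other members of \<open>S\<close> have no term
    of that type, and symmetry extends the agreement to the whole orbit.\<close>
  define c where "c M = coeff f (w M) / coeff (power_sums M) (w M)" for M
  define g where "g = (\<Sum>M\<in>S. scale (c M) (power_sums M))"
  have g: "coeff g m = (\<Sum>M\<in>S. c M * coeff (power_sums M) m)" for m
    by (simp add: g_def coeff_sum scale.rep_eq)
  have "g \<in> symfun.span power_sum_basis"
    unfolding g_def
    by (intro symfun.span_sum symfun.span_scale symfun.span_base)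
       (auto simp: power_sum_basis_def S0)
  moreover have "f - g \<in> symfun.span power_sum_basis"
  proof (rule Suc.IH, rule ccontr)
    fix m assume m: "coeff (f - g) m \<noteq> 0" "\<not> size (exponents m) < L"
    have other: "coeff (power_sums M) m = 0" if "M \<in> S" "M \<noteq> exponents m" for M
      using coeff_power_sums_neq_0D[of M m] S0[of M] m(2) that by (auto simp: S_def)
    have "coeff g m = coeff f m"
    proof (cases "exponents m \<in> S")
      case True
      have "coeff g m = (\<Sum>M\<in>{exponents m}. c M * coeff (power_sums M) m)"
        unfolding g using True other \<open>finite S\<close> by (intro sum.mono_neutral_right) auto
      also have "\<dots> = coeff f m"
        using coeff_cong_exponents[OF w, of _ m]
          coeff_power_sums_exponents_neq_0[of m "exponents m"]
        by (simp add: c_def)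
      finally show ?thesis .
    next
      case False
      then have "coeff g m = 0"
        unfolding g using other by (intro sum.neutral) auto
      moreover have "coeff f m = 0"
        using False d[of m] Suc.prems[of m] m(2) by (force simp: S_def)
      ultimately show ?thesis
        by simp
    qed
    with m show False
      by (simp add: coeff_diff)
  qed
  ultimately show ?case
    using symfun.span_add[of g _ "f - g"] by simp
qed

lemma span_power_sum_basis: "symfun.span power_sum_basis = UNIV"
proof (intro set_eqI iffI UNIV_I)
  fix f
  obtain d where d: "\<And>m. coeff f m \<noteq> 0 \<Longrightarrow> size m \<le> d"
    using coeff[of f] by auto
  have "finite (size ` exponents ` {m. size m \<le> d})"
    using finite_exponents_bounded_size by blast
  then obtain L where "\<And>m. size m \<le> d \<Longrightarrow> size (exponents m) < L"
    by (metis (no_types, lifting) finite_nat_set_iff_bounded image_eqI mem_Collect_eq)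
  with d show "f \<in> symfun.span power_sum_basis"
    using in_span_power_sum_basis by blast
qed


section \<open>Partitions as multisets\<close>

lemma ex_partition_of_mset:
  assumes "0 \<notin># M"
  shows "\<exists>\<nu>. is_partition \<nu> \<and> mset \<nu> = M"
  by (rule exI[of _ "rev (sorted_list_of_multiset M)"])
     (use assms in \<open>simp add: is_partition_def sorted_wrt_rev\<close>)

lemma partition_mset_inject:
  assumes "is_partition \<nu>" "is_partition \<mu>"
  shows "mset \<nu> = mset \<mu> \<longleftrightarrow> \<nu> = \<mu>"
proof
  assume "mset \<nu> = mset \<mu>"
  moreover have "sorted (rev \<nu>)" "sorted (rev \<mu>)"
    using assms by (simp_all add: is_partition_def sorted_wrt_rev)
  ultimately have "rev \<nu> = rev \<mu>"
    by (metis mset_rev properties_for_sort)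
  then show "\<nu> = \<mu>"
    by simp
qed simp

definition z_mset :: "nat multiset \<Rightarrow> rat" where
  "z_mset M = (\<Prod>i\<in>set_mset M. of_nat (i ^ count M i * fact (count M i)))"

lemma z_partition_eq_z_mset: "z_partition \<nu> = z_mset (mset \<nu>)"
  by (simp add: z_partition_def z_mset_def count_mset)

text \<open>An index outside \<open>M\<close> contributes \<open>i ^ 0 * fact 0 = 1\<close>. This
  allows \<open>z_mset\<close> of several multisets to be compared factor by factor over one index
  set.\<close>

lemma z_mset_superset:
  assumes "finite A" "set_mset M \<subseteq> A"
  shows "z_mset M = (\<Prod>i\<in>A. of_nat (i ^ count M i * fact (count M i)))"
  unfolding z_mset_def using assms by (intro prod.mono_neutral_left) (auto simp: not_in_iff)

lemma z_mset_neq_0: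
  assumes "0 \<notin># M"
  shows "z_mset M \<noteq> 0"
  unfolding z_mset_def using assms by (auto intro: ccontr)


section \<open>The Hall inner product\<close>

interpretation symfun_functional: vector_space_pair scale "(*) :: rat \<Rightarrow> rat \<Rightarrow> rat"
  by unfold_locales (simp_all add: algebra_simps)

lemma linear_functionalI:
  assumes "\<And>f g. \<phi> (f + g) = \<phi> f + \<phi> g" "\<And>c f. \<phi> (scale c f) = c * \<phi> f"
  shows "Vector_Spaces.linear scale (*) \<phi>"
  using assms vector_space_scale symfun_functional.vs2.vector_space_axioms
  unfolding Vector_Spaces.linear_iff by blast

lemma power_sums_in_basis: "0 \<notin># M \<Longrightarrow> power_sums M \<in> power_sum_basis"
  by (simp add: power_sum_basis_def)

lemma linear_eq_if_eq_on_power_sums: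
  assumes "Vector_Spaces.linear scale (*) \<phi>" "Vector_Spaces.linear scale (*) \<psi>"
    and "\<And>M. 0 \<notin># M \<Longrightarrow> \<phi> (power_sums M) = \<psi> (power_sums M)"
  shows "\<phi> f = \<psi> f"
  by (rule symfun_functional.linear_eq_on[OF assms(1,2), of _ power_sum_basis])
     (use assms(3) span_power_sum_basis in \<open>auto simp: power_sum_basis_def\<close>)

section \<open>Coordinates and the diagonal form\<close>

abbreviation coord :: "symfun \<Rightarrow> symfun \<Rightarrow> rat" where
  "coord \<equiv> symfun.representation power_sum_basis"

lemma linear_coord: "Vector_Spaces.linear scale (*) (\<lambda>f. coord f v)"
  using symfun.linear_representation independent_power_sum_basis span_power_sum_basis by blast

lemma coord_add: "coord (f + g) v = coord f v + coord g v"
  and coord_scale: "coord (scale c f) v = c * coord f v"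
  using linear_coord[of v] unfolding Vector_Spaces.linear_iff by blast+

lemma coord_power_sums:
  assumes "0 \<notin># M" "0 \<notin># N"
  shows "coord (power_sums M) (power_sums N) = (if M = N then 1 else 0)"
  using assms inj_on_power_sums
  by (auto simp: symfun.representation_basis independent_power_sum_basis power_sums_in_basis
      dest: inj_onD)

lemma ex_hall_form:
  "\<exists>B. bilinear_form B \<and>
     (\<forall>M N. 0 \<notin># M \<longrightarrow> 0 \<notin># N \<longrightarrow> B (power_sums M) (power_sums N) = (if M = N then z_mset M else 0))"
proof -
  \<comment> \<open>The weight is moved from multisets to the basis vectors that they index, using
    injectivity of \<open>power_sums\<close>.\<close>
  define z where "z v = z_mset (inv_into {M. 0 \<notin># M} power_sums v)" for v
  have z: "z (power_sums M) = z_mset M" if "0 \<notin># M" for M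
    unfolding z_def using that by (simp add: inj_on_power_sums)
  \<comment> \<open>Summing over the support of \<open>coord f\<close> alone keeps the sum finite
    and makes linearity in \<open>g\<close> immediate. Linearity in \<open>f\<close> then follows
    from the symmetry \<open>B_sym\<close>.\<close>
  define B where "B f g = (\<Sum>v | coord f v \<noteq> 0. coord f v * coord g v * z v)" for f g
  have fin: "finite {v. coord f v \<noteq> 0}" for f
    by (rule symfun.finite_representation)
  have B_sym: "B f g = B g f" for f g
  proof -
    have *: "B f g = (\<Sum>v | coord f v \<noteq> 0 \<and> coord g v \<noteq> 0. coord f v * coord g v * z v)" for f g
      unfolding B_def using fin by (intro sum.mono_neutral_right) auto
    show ?thesis
      unfolding * by (auto intro!: sum.cong)
  qed
  have "Vector_Spaces.linear scale (*) (B f)" for f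
  proof (rule linear_functionalI)
    show "B f (g + h) = B f g + B f h" for g h
      unfolding B_def by (simp add: coord_add distrib_left distrib_right flip: sum.distrib)
    show "B f (scale c g) = c * B f g" for c g
      unfolding B_def sum_distrib_left by (rule sum.cong) (simp_all add: coord_scale)
  qed
  moreover from this have "Vector_Spaces.linear scale (*) (\<lambda>f. B f g)" for g
    by (subst B_sym) simp
  moreover have "B (power_sums M) (power_sums N) = (if M = N then z_mset M else 0)"
    if "0 \<notin># M" "0 \<notin># N" for M N
  proof -
    have "{v. coord (power_sums M) v \<noteq> 0} = {power_sums M}"
      using that
      by (auto simp: symfun.representation_basis independent_power_sum_basis power_sums_in_basis)
    then show ?thesis
      using that by (auto simp: B_def coord_power_sums z)
  qed
  ultimately show ?thesis
    unfolding bilinear_form_def by blast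
qed

text \<open>This justifies the definite description in \<open>hall\<close>. Two such forms agree on
  pairs of basis elements; linearity extends the agreement first to all second arguments and then to
  all first arguments.\<close>

lemma hall_unique:
  "\<exists>!B. bilinear_form B \<and>
     (\<forall>\<nu> \<mu>. is_partition \<nu> \<longrightarrow> is_partition \<mu> \<longrightarrow>
        B (psums \<nu>) (psums \<mu>) = (if \<nu> = \<mu> then z_partition \<nu> else 0))"
  (is "\<exists>!B. ?P B")
proof (rule ex_ex1I)
  have 0: "0 \<notin># mset \<nu>" if "is_partition \<nu>" for \<nu>
    using that by (simp add: is_partition_def)
  show "\<exists>B. ?P B"
    using ex_hall_form
    by (elim ex_forward) (simp add: psums_eq_power_sums z_partition_eq_z_mset partition_mset_inject 0[simplified])
  fix B C assume B: "?P B" and C: "?P C"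
  have basis: "B (power_sums M) (power_sums N) = C (power_sums M) (power_sums N)"
    if "0 \<notin># M" "0 \<notin># N" for M N
    using ex_partition_of_mset[OF that(1)] ex_partition_of_mset[OF that(2)] B C
    by (auto simp: psums_eq_power_sums)
  have "B (power_sums M) g = C (power_sums M) g" if "0 \<notin># M" for M g
    by (rule linear_eq_if_eq_on_power_sums) (use B C basis that in \<open>auto simp: bilinear_form_def\<close>)
  then have "B f g = C f g" for f g
    using linear_eq_if_eq_on_power_sums[of "\<lambda>f. B f g" "\<lambda>f. C f g"] B C
    by (auto simp: bilinear_form_def)
  then show "B = C"
    by blast
qed

lemma bilinear_form_hall: "bilinear_form hall"
  using theI'[OF hall_unique] unfolding hall_def by blast

lemma linear_hall_left: "Vector_Spaces.linear scale (*) (\<lambda>f. hall f g)"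
  and linear_hall_right: "Vector_Spaces.linear scale (*) (hall f)"
  using bilinear_form_hall by (simp_all add: bilinear_form_def)

lemma hall_power_sums:
  assumes "0 \<notin># M" "0 \<notin># N"
  shows "hall (power_sums M) (power_sums N) = (if M = N then z_mset M else 0)"
proof -
  obtain \<nu> \<mu> where "is_partition \<nu>" "mset \<nu> = M" "is_partition \<mu>" "mset \<mu> = N"
    using assms ex_partition_of_mset by meson
  moreover from this have "hall (psums \<nu>) (psums \<mu>) = (if \<nu> = \<mu> then z_partition \<nu> else 0)"
    using theI'[OF hall_unique] unfolding hall_def by blast
  ultimately show ?thesis
    using partition_mset_inject by (auto simp: psums_eq_power_sums z_partition_eq_z_mset)
qed

section \<open>Nondegeneracy and adjoints\<close>

lemma hall_power_sums_right:
  assumes "0 \<notin># N"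
  shows "hall f (power_sums N) = coord f (power_sums N) * z_mset N"
proof (rule linear_eq_if_eq_on_power_sums[OF linear_hall_left])
  show "Vector_Spaces.linear scale (*) (\<lambda>f. coord f (power_sums N) * z_mset N)"
    by (rule linear_functionalI) (simp_all add: coord_add coord_scale distrib_right)
qed (use assms in \<open>simp add: hall_power_sums coord_power_sums\<close>)

text \<open>Pairing with a basis element reads off a coordinate up to a nonzero factor, so the
  pairings determine \<open>f\<close>. This is what makes an adjoint in the sense of
  \<open>perp\<close> unique.\<close>

lemma hall_nondegenerate:
  assumes "\<And>g. hall f g = hall f' g"
  shows "f = f'"
proof -
  have "coord f v = coord f' v" for v
  proof (cases "v \<in> power_sum_basis")
    case True
    then obtain M where "0 \<notin># M" "v = power_sums M"
      by (auto simp: power_sum_basis_def)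
    then show ?thesis
      using assms[of v] z_mset_neq_0 by (simp add: hall_power_sums_right)
  next
    case False
    then show ?thesis
      by (metis symfun.representation_ne_zero)
  qed
  then have "coord f = coord f'"
    by blast
  then show ?thesis
    by (metis UNIV_I independent_power_sum_basis span_power_sum_basis
        symfun.sum_nonzero_representation_eq)
qed

text \<open>Test both sides against \<open>power_sums K\<close>. Orthogonality leaves only
  \<open>M = N + K\<close>, that is \<open>N \<subseteq># M\<close> and \<open>K = M - N\<close>,
  and the quotient of the \<open>z\<close> factors converts the norm of
  \<open>power_sums (M - N)\<close> into that of \<open>power_sums M\<close>.\<close>

lemma perp_power_sums:
  assumes "0 \<notin># M" "0 \<notin># N"
  shows "perp (power_sums N) (power_sums M)
    = (if N \<subseteq># M then scale (z_mset M / z_mset (M - N)) (power_sums (M - N)) else 0)"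
    (is "_ = ?R")
  unfolding perp_def
proof (rule the_equality)
  show "\<forall>Q. hall ?R Q = hall (power_sums M) (power_sums N * Q)"
  proof
    fix Q
    show "hall ?R Q = hall (power_sums M) (power_sums N * Q)"
    proof (rule linear_eq_if_eq_on_power_sums[OF linear_hall_right])
      show "Vector_Spaces.linear scale (*) (\<lambda>Q. hall (power_sums M) (power_sums N * Q))"
        using linear_hall_right[of "power_sums M"] unfolding Vector_Spaces.linear_iff
        by (simp add: distrib_left scale_mult_right)
    next
      fix K :: "nat multiset" assume K: "0 \<notin># K"
      have "0 \<notin># M - N"
        using assms by (meson in_diffD)
      have scale: "hall (scale c f) g = c * hall f g" "hall 0 g = 0" for c f g
        using linear_hall_left[of g] unfolding Vector_Spaces.linear_iff
        by (blast, metis mult_zero_left symfun.scale_zero_left)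
      have "hall (power_sums M) (power_sums N * power_sums K) = (if M = N + K then z_mset M else 0)"
        using assms K hall_power_sums[of M "N + K"] by (simp add: power_sums_union)
      also have "\<dots> = hall ?R (power_sums K)"
        using hall_power_sums[OF \<open>0 \<notin># M - N\<close> K] z_mset_neq_0[OF K]
        by (auto simp: scale)
      finally show "hall ?R (power_sums K) = hall (power_sums M) (power_sums N * power_sums K)"
        by simp
    qed
  qed
  then show "R = ?R" if "\<forall>Q. hall R Q = hall (power_sums M) (power_sums N * Q)" for R
    using that by (intro hall_nondegenerate) simp
qed


section \<open>The binomial theorem for multisets\<close>

text \<open>Only meaningful for \<open>N \<subseteq># M\<close>: elements of \<open>N\<close> outside \<open>M\<close> are ignored.\<close>

definition mset_choose :: "'a multiset \<Rightarrow> 'a multiset \<Rightarrow> nat" where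
  "mset_choose M N = (\<Prod>i\<in>set_mset M. count M i choose count N i)"

text \<open>Pascal's rule at \<open>x\<close>; all other factors form the common product
  \<open>b\<close>. The guard \<open>N \<subseteq># M\<close> matters when \<open>x\<close> lies in
  \<open>N\<close> but not in \<open>M\<close>, where \<open>mset_choose M N\<close> would ignore
  \<open>x\<close> instead of vanishing.\<close>

lemma mset_choose_add_mset:
  assumes "N \<subseteq># add_mset x M"
  shows "mset_choose (add_mset x M) N
    = (if x \<in># N then mset_choose M (N - {#x#}) else 0) + (if N \<subseteq># M then mset_choose M N else 0)"
proof -
  define B where "B = set_mset M - {x}"
  have B: "finite B" "x \<notin> B"
    by (simp_all add: B_def)
  define b where "b = (\<Prod>i\<in>B. count M i choose count N i)"
  have split: "mset_choose M K = (count M x choose count K x) * (\<Prod>i\<in>B. count M i choose count K i)"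
    if "K \<subseteq># M" for K
  proof -
    have "mset_choose M K = (\<Prod>i\<in>insert x (set_mset M). count M i choose count K i)"
      unfolding mset_choose_def
    proof (rule prod.mono_neutral_left)
      show "\<forall>i\<in>insert x (set_mset M) - set_mset M. count M i choose count K i = 1"
        using that by (metis DiffD2 binomial_n_0 count_eq_zero_iff mset_subset_eqD)
    qed auto
    also have "insert x (set_mset M) = insert x B"
      by (auto simp: B_def)
    finally show ?thesis
      using B by simp
  qed
  have "mset_choose (add_mset x M) N
      = (\<Prod>i\<in>insert x B. count (add_mset x M) i choose count N i)"
    unfolding mset_choose_def by (intro prod.cong) (auto simp: B_def)
  also have "\<dots> = (Suc (count M x) choose count N x) * (\<Prod>i\<in>B. count (add_mset x M) i choose count N i)"
    using B by simp
  also have "(\<Prod>i\<in>B. count (add_mset x M) i choose count N i) = b"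
    unfolding b_def by (intro prod.cong) (auto simp: B_def)
  finally have lhs: "mset_choose (add_mset x M) N = (Suc (count M x) choose count N x) * b" .
  have snd: "(if N \<subseteq># M then mset_choose M N else 0) = (count M x choose count N x) * b"
  proof (cases "N \<subseteq># M")
    case True
    then show ?thesis
      by (simp add: split b_def)
  next
    case False
    have "count N i \<le> count M i" if "i \<noteq> x" for i
      using mset_subset_eq_count[OF assms, of i] that by auto
    \<comment> \<open>Since \<open>N\<close> fits into \<open>add_mset x M\<close>, it can exceed
      \<open>M\<close> only at \<open>x\<close>, and there the binomial coefficient is zero.\<close>
    then have "count N x > count M x"
      using False by (metis not_le mset_subset_eqI)
    then show ?thesis
      using False by simp
  qed
  show ?thesis
  proof (cases "x \<in># N")
    case True
    then obtain n where n: "count N x = Suc n"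
      by (metis count_eq_zero_iff not0_implies_Suc)
    have "N - {#x#} \<subseteq># M"
      using assms by (simp add: subset_eq_diff_conv)
    then have "mset_choose M (N - {#x#})
        = (count M x choose n) * (\<Prod>i\<in>B. count M i choose count (N - {#x#}) i)"
      using n by (simp add: split)
    also have "(\<Prod>i\<in>B. count M i choose count (N - {#x#}) i) = b"
      unfolding b_def by (rule prod.cong) (auto simp: B_def)
    finally have "mset_choose M (N - {#x#}) = (count M x choose n) * b" .
    then show ?thesis
      using True n by (simp add: lhs snd algebra_simps)
  next
    case False
    then have "count N x = 0"
      by (simp add: not_in_iff)
    with False show ?thesis
      by (simp add: lhs snd)
  qed
qed

lemma finite_submsets: "finite {N. N \<subseteq># M}"
  by (rule finite_subset[OF _ finite_bounded_msets[of "set_mset M" "size M"]])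
     (auto simp: size_mset_mono dest: mset_subset_eqD)

text \<open>Expanding the product chooses \<open>f\<close> or \<open>g\<close> for each occurrence
  of an element, and \<open>mset_choose M N\<close> counts the choices whose \<open>f\<close>-part
  is \<open>N\<close>. In the induction, Pascal's rule separates the choices for the new
  \<open>x\<close>.\<close>

lemma prod_mset_add_binomial:
  fixes f g :: "'a \<Rightarrow> 'b :: comm_semiring_1"
  shows "(\<Sum>N | N \<subseteq># M. of_nat (mset_choose M N) * (\<Prod>x\<in>#N. f x) * (\<Prod>x\<in>#M - N. g x))
    = (\<Prod>x\<in>#M. f x + g x)"
proof (induction M)
  case empty
  show ?case
    by (simp add: mset_choose_def)
next
  case (add x M)
  let ?F = "\<lambda>N. \<Prod>x\<in>#N. f x" and ?G = "\<lambda>N. \<Prod>x\<in>#N. g x"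
  let ?M = "add_mset x M"
  let ?c = "\<lambda>N. of_nat (mset_choose M N) :: 'b"
  have fin: "finite {N. N \<subseteq># ?M}"
    by (rule finite_submsets)
  have "(\<Sum>N | N \<subseteq># ?M. of_nat (mset_choose ?M N) * ?F N * ?G (?M - N))
      = (\<Sum>N | N \<subseteq># ?M. (if x \<in># N then ?c (N - {#x#}) * ?F N * ?G (?M - N) else 0)
          + (if N \<subseteq># M then ?c N * ?F N * ?G (?M - N) else 0))"
    by (rule sum.cong) (auto simp: mset_choose_add_mset algebra_simps)
  also have "\<dots> = (\<Sum>N | N \<subseteq># ?M \<and> x \<in># N. ?c (N - {#x#}) * ?F N * ?G (?M - N))
      + (\<Sum>N | N \<subseteq># ?M \<and> N \<subseteq># M. ?c N * ?F N * ?G (?M - N))"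
    using fin by (simp add: sum.distrib sum.inter_filter[symmetric])
  \<comment> \<open>The new \<open>x\<close> belongs to the \<open>f\<close>-part; removing it maps
    onto the submultisets of \<open>M\<close> and releases a factor \<open>f x\<close>. In the other
    sum \<open>x\<close> stays in the complement and releases \<open>g x\<close>.\<close>
  also have "(\<Sum>N | N \<subseteq># ?M \<and> x \<in># N. ?c (N - {#x#}) * ?F N * ?G (?M - N))
      = (\<Sum>N | N \<subseteq># M. f x * (?c N * ?F N * ?G (M - N)))"
    by (rule sum.reindex_bij_witness[where i = "add_mset x" and j = "\<lambda>N. N - {#x#}"])
       (auto simp: subset_eq_diff_conv algebra_simps dest!: multi_member_split)
  also have "(\<Sum>N | N \<subseteq># ?M \<and> N \<subseteq># M. ?c N * ?F N * ?G (?M - N))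
      = (\<Sum>N | N \<subseteq># M. g x * (?c N * ?F N * ?G (M - N)))"
  proof (rule sum.cong)
    have "M \<subseteq># ?M"
      by simp
    then show "{N. N \<subseteq># ?M \<and> N \<subseteq># M} = {N. N \<subseteq># M}"
      using subset_mset.trans by blast
    fix N assume "N \<in> {N. N \<subseteq># M}"
    then have "?M - N = add_mset x (M - N)"
      by (intro multiset_eqI) (simp add: Suc_diff_le mset_subset_eq_count)
    then show "?c N * ?F N * ?G (?M - N) = g x * (?c N * ?F N * ?G (M - N))"
      by (simp add: mult_ac)
  qed
  finally show ?case
    by (simp add: add.IH distrib_right flip: sum_distrib_left)
qed

text \<open>For each element this is \<open>c! = (c choose n) * n! * (c - n)!\<close> together with
  a splitting of the power \<open>i ^ c\<close>. It reduces all \<open>z\<close> factors in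
  \<open>CP\<close> to the integer \<open>mset_choose M N\<close>.\<close>

lemma z_mset_eq_mset_choose:
  assumes "N \<subseteq># M"
  shows "z_mset M = of_nat (mset_choose M N) * z_mset N * z_mset (M - N)"
proof -
  have "set_mset N \<subseteq> set_mset M" "set_mset (M - N) \<subseteq> set_mset M"
    using assms by (auto dest: mset_subset_eqD in_diffD)
  moreover have "i ^ count M i * fact (count M i)
      = (count M i choose count N i) * (i ^ count N i * fact (count N i))
        * (i ^ count (M - N) i * fact (count (M - N) i))" for i
  proof -
    have le: "count N i \<le> count M i"
      using assms by (simp add: mset_subset_eq_count)
    have "i ^ count M i = i ^ count N i * i ^ count (M - N) i"
      using le by (simp flip: power_add)
    then show ?thesis
      using binomial_fact_lemma[OF le] by (simp add: algebra_simps)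
  qed
  ultimately show ?thesis
    by (simp only: z_mset_superset[of "set_mset M"] mset_choose_def finite_set_mset of_nat_prod
        of_nat_mult subset_refl prod.distrib)
qed


section \<open>Evaluation of \<open>CP\<close>\<close>

lemma scale_of_nat: "scale (of_nat n) f = of_nat n * f"
  by (induction n) (simp_all add: symfun.scale_left_distrib distrib_right)

lemma CP_power_sums:
  assumes "0 \<notin># M"
  shows "CP a k (power_sums M) = (\<Sum>N | N \<subseteq># M \<and> size N \<le> k.
    psum a ^ (k - size N) * (\<Prod>n\<in>#N. psum (n + a) - psum n * psum a)
      * (of_nat (mset_choose M N) * power_sums (M - N)))"
    (is "_ = sum ?g _")
proof -
  let ?h = "\<lambda>\<nu>. if is_partition \<nu> \<and> length \<nu> \<le> k
     then psum a ^ (k - length \<nu>) * (\<Prod>i<length \<nu>. psum (\<nu> ! i + a) - psum (\<nu> ! i) * psum a)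
            * scale (1 / z_partition \<nu>) (perp (psums \<nu>) (power_sums M))
     else 0"
  let ?S = "{\<nu>. is_partition \<nu> \<and> mset \<nu> \<subseteq># M \<and> length \<nu> \<le> k}"
  have part: "0 \<notin># mset \<nu>" if "is_partition \<nu>" for \<nu>
    using that by (simp add: is_partition_def)
  have inj: "inj_on mset ?S"
    by (auto intro!: inj_onI simp: partition_mset_inject)
  have img: "mset ` ?S = {N. N \<subseteq># M \<and> size N \<le> k}"
  proof (intro set_eqI iffI)
    fix N assume N: "N \<in> {N. N \<subseteq># M \<and> size N \<le> k}"
    then have "0 \<notin># N"
      using assms by (auto dest: mset_subset_eqD)
    then obtain \<nu> where "is_partition \<nu>" "mset \<nu> = N"
      using ex_partition_of_mset by blast
    with N show "N \<in> mset ` ?S"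
      by auto
  qed auto
  have "finite (mset ` ?S)"
    unfolding img using finite_submsets[of M] by (rule rev_finite_subset) auto
  then have "finite ?S"
    using inj finite_imageD by blast
  \<comment> \<open>The adjoint kills \<open>power_sums M\<close> unless the parts of
    \<open>\<nu>\<close> form a submultiset of \<open>M\<close>, so the formal sum over all
    partitions becomes a finite sum.\<close>
  moreover have "{\<nu>. ?h \<nu> \<noteq> 0} \<subseteq> ?S"
    using perp_power_sums[OF assms part] by (auto simp: psums_eq_power_sums split: if_splits)
  ultimately have "CP a k (power_sums M) = sum ?h ?S"
    unfolding CP_def by (rule Sum_any.expand_superset)
  also have "\<dots> = (\<Sum>\<nu>\<in>?S. ?g (mset \<nu>))"
  proof (rule sum.cong)
    fix \<nu> assume \<nu>: "\<nu> \<in> ?S"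
    then have 0: "0 \<notin># mset \<nu>" "0 \<notin># M - mset \<nu>"
      using part assms by (auto dest: in_diffD)
    have "scale (1 / z_partition \<nu>) (perp (psums \<nu>) (power_sums M))
        = scale (of_nat (mset_choose M (mset \<nu>))) (power_sums (M - mset \<nu>))"
      using \<nu> 0 z_mset_eq_mset_choose[of "mset \<nu>" M] z_mset_neq_0[OF 0(1)] z_mset_neq_0[OF 0(2)]
      by (simp add: psums_eq_power_sums z_partition_eq_z_mset perp_power_sums assms)
    moreover have "(\<Prod>i<length \<nu>. psum (\<nu> ! i + a) - psum (\<nu> ! i) * psum a)
        = (\<Prod>n\<in>#mset \<nu>. psum (n + a) - psum n * psum a)"
      by (simp add: prod_mset_prod_list prod.list_conv_set_nth atLeast0LessThan flip: mset_map)
    ultimately show "?h \<nu> = ?g (mset \<nu>)"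
      using \<nu> by (simp add: scale_of_nat)
  qed simp
  also have "\<dots> = sum ?g (mset ` ?S)"
    using inj by (simp add: sum.reindex)
  finally show ?thesis
    unfolding img .
qed

lemma psums_add_rect:
  assumes "length \<mu> \<le> k"
  shows "psums (add_rect \<mu> a k) = psum a ^ (k - length \<mu>) * (\<Prod>n\<in>#mset \<mu>. psum (n + a))"
proof -
  have "[0..<k] = [0..<length \<mu>] @ [length \<mu>..<k]"
    using assms by (metis le_add_diff_inverse upt_add_eq_append zero_le)
  moreover have "map (\<lambda>i. psum (nth_part \<mu> i + a)) [0..<length \<mu>] = map (\<lambda>n. psum (n + a)) \<mu>"
    by (rule nth_equalityI) (simp_all add: nth_part_def)
  moreover have "map (\<lambda>i. psum (nth_part \<mu> i + a)) [length \<mu>..<k] = replicate (k - length \<mu>) (psum a)"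
    by (rule nth_equalityI) (simp_all add: nth_part_def)
  ultimately show ?thesis
    by (simp add: psums_def add_rect_def comp_def mult.commute
        flip: prod_mset_prod_list)
qed

theorem mainTheorem1:
  fixes a k :: nat and \<mu> :: "nat list"
  assumes "a > 0" and "is_partition \<mu>" and "length \<mu> < k"
  shows "CP a k (psums \<mu>) = psums (add_rect \<mu> a k)"
proof -
  define M where "M = mset \<mu>"
  have "0 \<notin># M" and size: "size M < k"
    using assms by (simp_all add: M_def is_partition_def)
  let ?q = "\<lambda>n. psum (n + a) - psum n * psum a"
  have "CP a k (psums \<mu>) = (\<Sum>N | N \<subseteq># M \<and> size N \<le> k.
      psum a ^ (k - size N) * (\<Prod>n\<in>#N. ?q n) * (of_nat (mset_choose M N) * power_sums (M - N)))"
    using CP_power_sums[OF \<open>0 \<notin># M\<close>] by (simp add: psums_eq_power_sums M_def)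
  also have "\<dots> = (\<Sum>N | N \<subseteq># M. psum a ^ (k - size M)
      * (of_nat (mset_choose M N) * (\<Prod>n\<in>#N. ?q n) * (\<Prod>n\<in>#M - N. psum n * psum a)))"
  proof (rule sum.cong)
    show "{N. N \<subseteq># M \<and> size N \<le> k} = {N. N \<subseteq># M}"
      using size by (auto dest: size_mset_mono)
    fix N assume "N \<in> {N. N \<subseteq># M}"
    \<comment> \<open>Of the \<open>k - size N\<close> factors \<open>psum a\<close>, one goes to
      each part of \<open>M - N\<close>, and the remaining \<open>k - size M\<close> form a factor
      independent of \<open>N\<close>.\<close>
    then have "k - size N = (k - size M) + size (M - N)"
      using size size_mset_mono[of N M] by (simp add: size_Diff_submset)
    then show "psum a ^ (k - size N) * (\<Prod>n\<in>#N. ?q n) * (of_nat (mset_choose M N) * power_sums (M - N))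
        = psum a ^ (k - size M)
          * (of_nat (mset_choose M N) * (\<Prod>n\<in>#N. ?q n) * (\<Prod>n\<in>#M - N. psum n * psum a))"
      by (simp add: power_add prod_mset.distrib power_sums_def mult_ac)
  qed
  \<comment> \<open>In the binomial expansion the summands attached to a part \<open>n\<close> are
    \<open>?q n\<close> and \<open>psum n * psum a\<close>, whose sum telescopes to
    \<open>psum (n + a)\<close>.\<close>
  also have "\<dots> = psum a ^ (k - size M) * (\<Prod>n\<in>#M. psum (n + a))"
    by (simp add: prod_mset_add_binomial flip: sum_distrib_left)
  also have "\<dots> = psums (add_rect \<mu> a k)"
    using assms by (simp add: psums_add_rect M_def)
  finally show ?thesis .
qed

end
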